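(* Every co-Heyting algebra existentially closed in the variety $\mathcal V_2$ satisfies the density axiom D2 and the splitting axiom S2.
   Context: A co-Heyting algebra is a bounded distributive lattice $(L,\mathbf{0},\mathbf{1},\vee,\wedge)$ with a binary operation $-$ such that $a-b$ is the least $c\in L$ with $a\le b\vee c$; it is a structure in the language $\{\mathbf 0,\mathbf 1,\vee,\wedge,-\}$ and extensions are taken in this language. For $a,b\in L$ write $b\ll a$ iff $a-b=a$ and $b\le a$. $\mathcal V_2$ is the variety of co-Heyting algebras satisfying the identity $(\mathbf 1-x)\wedge(\mathbf 1-(\mathbf 1-x))=\mathbf 0$. An algebra $L\in\mathcal V_2$ is existentially closed in $\mathcal V_2$ if every existential formula with parameters in $L$ true in some extension of $L$ in $\mathcal V_2$ is true in $L$. Axiom D2: for all $a,c$ with $c\ll a$ and $a\neq\mathbf 0$ there is $b\neq\mathbf 0$ with $c\ll b\ll a$. Axiom S2: for all $a,b_1,b_2$ with $b_1\vee b_2\ll a\ne\mathbf 0$ and $b_1\wedge b_2\wedge(\mathbf 1-(\mathbf 1-a))=\mathbf 0$ there are non-zero $a_1,a_2$ with $a-a_2=a_1\ge b_1$, $a-a_1=a_2\ge b_2$, and $a_1\wedge a_2=b_1\wedge b_2$. *)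

theory Defs
  imports Main
begin

record 'a coheyting =
  carrier :: "'a set"
  bottom :: 'a (\<open>\<zero>\<index>\<close>)
  top_elem :: 'a (\<open>\<one>\<index>\<close>)
  join :: "'a \<Rightarrow> 'a \<Rightarrow> 'a" (infixl \<open>\<squnion>\<index>\<close> 65)
  meet :: "'a \<Rightarrow> 'a \<Rightarrow> 'a" (infixl \<open>\<sqinter>\<index>\<close> 70)
  diff :: "'a \<Rightarrow> 'a \<Rightarrow> 'a" (infixl \<open>\<ominus>\<index>\<close> 65)

definition le :: "'a coheyting \<Rightarrow> 'a \<Rightarrow> 'a \<Rightarrow> bool" (infix \<open>\<sqsubseteq>\<index>\<close> 50)
  where "x \<sqsubseteq>\<^bsub>L\<^esub> y \<longleftrightarrow> x \<sqinter>\<^bsub>L\<^esub> y = x"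

definition strongly_below :: "'a coheyting \<Rightarrow> 'a \<Rightarrow> 'a \<Rightarrow> bool" (infix \<open>\<lless>\<index>\<close> 50)
  where "b \<lless>\<^bsub>L\<^esub> a \<longleftrightarrow> a \<ominus>\<^bsub>L\<^esub> b = a \<and> b \<sqsubseteq>\<^bsub>L\<^esub> a"

text \<open>The one-element algebra is not excluded: varieties contain it.\<close>

locale coheyting_algebra =
  fixes L :: "'a coheyting" (structure)
  assumes bottom_closed [simp, intro]: "\<zero> \<in> carrier L"
    and top_closed [simp, intro]: "\<one> \<in> carrier L"
    and join_closed [simp, intro]: "\<lbrakk>x \<in> carrier L; y \<in> carrier L\<rbrakk> \<Longrightarrow> x \<squnion> y \<in> carrier L"
    and meet_closed [simp, intro]: "\<lbrakk>x \<in> carrier L; y \<in> carrier L\<rbrakk> \<Longrightarrow> x \<sqinter> y \<in> carrier L"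
    and diff_closed [simp, intro]: "\<lbrakk>x \<in> carrier L; y \<in> carrier L\<rbrakk> \<Longrightarrow> x \<ominus> y \<in> carrier L"
    and join_comm: "\<lbrakk>x \<in> carrier L; y \<in> carrier L\<rbrakk> \<Longrightarrow> x \<squnion> y = y \<squnion> x"
    and meet_comm: "\<lbrakk>x \<in> carrier L; y \<in> carrier L\<rbrakk> \<Longrightarrow> x \<sqinter> y = y \<sqinter> x"
    and join_assoc:
      "\<lbrakk>x \<in> carrier L; y \<in> carrier L; z \<in> carrier L\<rbrakk> \<Longrightarrow> (x \<squnion> y) \<squnion> z = x \<squnion> (y \<squnion> z)"
    and meet_assoc:
      "\<lbrakk>x \<in> carrier L; y \<in> carrier L; z \<in> carrier L\<rbrakk> \<Longrightarrow> (x \<sqinter> y) \<sqinter> z = x \<sqinter> (y \<sqinter> z)"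
    and join_absorb: "\<lbrakk>x \<in> carrier L; y \<in> carrier L\<rbrakk> \<Longrightarrow> x \<squnion> (x \<sqinter> y) = x"
    and meet_absorb: "\<lbrakk>x \<in> carrier L; y \<in> carrier L\<rbrakk> \<Longrightarrow> x \<sqinter> (x \<squnion> y) = x"
    and meet_join_distrib:
      "\<lbrakk>x \<in> carrier L; y \<in> carrier L; z \<in> carrier L\<rbrakk> \<Longrightarrow> x \<sqinter> (y \<squnion> z) = (x \<sqinter> y) \<squnion> (x \<sqinter> z)"
    and bottom_least: "x \<in> carrier L \<Longrightarrow> \<zero> \<sqsubseteq> x"
    and top_greatest: "x \<in> carrier L \<Longrightarrow> x \<sqsubseteq> \<one>"
    and diff_upper: "\<lbrakk>a \<in> carrier L; b \<in> carrier L\<rbrakk> \<Longrightarrow> a \<sqsubseteq> b \<squnion> (a \<ominus> b)"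
    and diff_least:
      "\<lbrakk>a \<in> carrier L; b \<in> carrier L; c \<in> carrier L; a \<sqsubseteq> b \<squnion> c\<rbrakk> \<Longrightarrow> a \<ominus> b \<sqsubseteq> c"

locale V2_algebra = coheyting_algebra +
  assumes V2_identity: "x \<in> carrier L \<Longrightarrow> (\<one> \<ominus> x) \<sqinter> (\<one> \<ominus> (\<one> \<ominus> x)) = \<zero>"

definition axiom_D2 :: "'a coheyting \<Rightarrow> bool" where
  "axiom_D2 L \<longleftrightarrow>
    (\<forall>a\<in>carrier L. \<forall>c\<in>carrier L. c \<lless>\<^bsub>L\<^esub> a \<and> a \<noteq> \<zero>\<^bsub>L\<^esub> \<longrightarrow>
      (\<exists>b\<in>carrier L. b \<noteq> \<zero>\<^bsub>L\<^esub> \<and> c \<lless>\<^bsub>L\<^esub> b \<and> b \<lless>\<^bsub>L\<^esub> a))"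

definition axiom_S2 :: "'a coheyting \<Rightarrow> bool" where
  "axiom_S2 L \<longleftrightarrow>
    (\<forall>a\<in>carrier L. \<forall>b1\<in>carrier L. \<forall>b2\<in>carrier L.
      b1 \<squnion>\<^bsub>L\<^esub> b2 \<lless>\<^bsub>L\<^esub> a \<and> a \<noteq> \<zero>\<^bsub>L\<^esub> \<and>
      b1 \<sqinter>\<^bsub>L\<^esub> b2 \<sqinter>\<^bsub>L\<^esub> (\<one>\<^bsub>L\<^esub> \<ominus>\<^bsub>L\<^esub> (\<one>\<^bsub>L\<^esub> \<ominus>\<^bsub>L\<^esub> a)) = \<zero>\<^bsub>L\<^esub> \<longrightarrow>
      (\<exists>a1\<in>carrier L. \<exists>a2\<in>carrier L. a1 \<noteq> \<zero>\<^bsub>L\<^esub> \<and> a2 \<noteq> \<zero>\<^bsub>L\<^esub> \<and>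
        a \<ominus>\<^bsub>L\<^esub> a2 = a1 \<and> b1 \<sqsubseteq>\<^bsub>L\<^esub> a1 \<and>
        a \<ominus>\<^bsub>L\<^esub> a1 = a2 \<and> b2 \<sqsubseteq>\<^bsub>L\<^esub> a2 \<and>
        a1 \<sqinter>\<^bsub>L\<^esub> a2 = b1 \<sqinter>\<^bsub>L\<^esub> b2))"

datatype 'v trm =
    Var 'v
  | Zero
  | One
  | Join "'v trm" "'v trm"
  | Meet "'v trm" "'v trm"
  | Diff "'v trm" "'v trm"

datatype fm =
    Eq "nat trm" "nat trm"
  | Neg fm
  | And fm fm
  | Or fm fm
  | Ex nat fm

primrec eval :: "'a coheyting \<Rightarrow> ('v \<Rightarrow> 'a) \<Rightarrow> 'v trm \<Rightarrow> 'a" where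
  "eval M v (Var x) = v x"
| "eval M v Zero = \<zero>\<^bsub>M\<^esub>"
| "eval M v One = \<one>\<^bsub>M\<^esub>"
| "eval M v (Join s t) = eval M v s \<squnion>\<^bsub>M\<^esub> eval M v t"
| "eval M v (Meet s t) = eval M v s \<sqinter>\<^bsub>M\<^esub> eval M v t"
| "eval M v (Diff s t) = eval M v s \<ominus>\<^bsub>M\<^esub> eval M v t"

primrec sat :: "'a coheyting \<Rightarrow> (nat \<Rightarrow> 'a) \<Rightarrow> fm \<Rightarrow> bool" where
  "sat M v (Eq s t) \<longleftrightarrow> eval M v s = eval M v t"
| "sat M v (Neg p) \<longleftrightarrow> \<not> sat M v p"
| "sat M v (And p q) \<longleftrightarrow> sat M v p \<and> sat M v q"
| "sat M v (Or p q) \<longleftrightarrow> sat M v p \<or> sat M v q"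
| "sat M v (Ex n p) \<longleftrightarrow> (\<exists>x\<in>carrier M. sat M (v(n := x)) p)"

primrec quantifier_free :: "fm \<Rightarrow> bool" where
  "quantifier_free (Eq s t) \<longleftrightarrow> True"
| "quantifier_free (Neg p) \<longleftrightarrow> quantifier_free p"
| "quantifier_free (And p q) \<longleftrightarrow> quantifier_free p \<and> quantifier_free q"
| "quantifier_free (Or p q) \<longleftrightarrow> quantifier_free p \<and> quantifier_free q"
| "quantifier_free (Ex n p) \<longleftrightarrow> False"

inductive existential :: "fm \<Rightarrow> bool" where
  existential_qf: "quantifier_free p \<Longrightarrow> existential p"
| existential_Ex: "existential p \<Longrightarrow> existential (Ex n p)"

text \<open>An extension of L is given, up to isomorphism over L, by an embedding of L.\<close>

definition embedding :: "'a coheyting \<Rightarrow> 'b coheyting \<Rightarrow> ('a \<Rightarrow> 'b) \<Rightarrow> bool" where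
  "embedding L M f \<longleftrightarrow>
    f ` carrier L \<subseteq> carrier M \<and> inj_on f (carrier L) \<and>
    f \<zero>\<^bsub>L\<^esub> = \<zero>\<^bsub>M\<^esub> \<and> f \<one>\<^bsub>L\<^esub> = \<one>\<^bsub>M\<^esub> \<and>
    (\<forall>x\<in>carrier L. \<forall>y\<in>carrier L.
      f (x \<squnion>\<^bsub>L\<^esub> y) = f x \<squnion>\<^bsub>M\<^esub> f y \<and>
      f (x \<sqinter>\<^bsub>L\<^esub> y) = f x \<sqinter>\<^bsub>M\<^esub> f y \<and>
      f (x \<ominus>\<^bsub>L\<^esub> y) = f x \<ominus>\<^bsub>M\<^esub> f y)"

text \<open>
  The free variables of \<open>p\<close> stand for the parameters, whose values in \<open>L\<close> are given
  by \<open>v\<close>.  A definition cannot quantify over the type of the extension \<open>M\<close>, so \<open>M\<close> is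
  taken over one fixed type, that of terms in elements of \<open>L\<close> and countably many new
  generators.  This is no restriction: an existential formula true in an extension is
  already true in the subalgebra generated by \<open>L\<close> and the witnesses, which has a copy
  over this type.  The theorem \<open>existentially_closed_V2_any_extension\<close> below confirms
  that extensions over an arbitrary type are covered.
\<close>

definition existentially_closed_V2 :: "'a coheyting \<Rightarrow> bool" where
  "existentially_closed_V2 L \<longleftrightarrow>
    V2_algebra L \<and>
    (\<forall>(M :: ('a + nat) trm coheyting) f p v.
      V2_algebra M \<and> embedding L M f \<and> existential p \<and> range v \<subseteq> carrier L \<and>
      sat M (f \<circ> v) p \<longrightarrow> sat L v p)"

lemma eval_carrier_update: "eval (M\<lparr>carrier := S\<rparr>) v t = eval M v t"
  by (induction t) auto

lemma sat_qf_carrier_update: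
  "quantifier_free p \<Longrightarrow> sat (M\<lparr>carrier := S\<rparr>) v p = sat M v p"
  by (induction p) (auto simp: eval_carrier_update)

lemma existential_witnesses:
  assumes "existential p" and "sat M w p" and "carrier M \<noteq> {}"
  shows "\<exists>u :: nat \<Rightarrow> 'a. range u \<subseteq> carrier M \<and>
    (\<forall>S. range u \<subseteq> S \<longrightarrow> sat (M\<lparr>carrier := S\<rparr>) w p)"
  using assms
proof (induction arbitrary: w)
  case (existential_qf p)
  then obtain x where "x \<in> carrier M" by blast
  then have "range (\<lambda>_ :: nat. x) \<subseteq> carrier M" by simp
  moreover have "sat (M\<lparr>carrier := S\<rparr>) w p" for S
    using existential_qf by (simp add: sat_qf_carrier_update)
  ultimately show ?case by blast
next
  case (existential_Ex p n)
  from existential_Ex.prems(1) obtain x where x: "x \<in> carrier M" "sat M (w(n := x)) p"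
    by (auto simp del: fun_upd_apply)
  from existential_Ex.IH[OF x(2) existential_Ex.prems(2)]
  obtain u :: "nat \<Rightarrow> 'a" where u: "range u \<subseteq> carrier M \<and>
    (\<forall>S. range u \<subseteq> S \<longrightarrow> sat (M\<lparr>carrier := S\<rparr>) (w(n := x)) p)" ..
  let ?u = "case_nat x u"
  have r: "range ?u = insert x (range u)"
  proof (intro equalityI subsetI)
    fix y assume "y \<in> range ?u"
    then obtain k where "y = ?u k" by blast
    then show "y \<in> insert x (range u)" by (cases k) simp_all
  next
    fix y assume "y \<in> insert x (range u)"
    then consider "y = ?u 0" | k where "y = ?u (Suc k)" by auto
    then show "y \<in> range ?u" by cases (simp_all only: rangeI)
  qed
  show ?case
  proof (intro exI[of _ ?u] conjI allI impI)
    show "range ?u \<subseteq> carrier M" unfolding r using x(1) u by simp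
    fix S assume "range ?u \<subseteq> S"
    then have "x \<in> S" "range u \<subseteq> S" unfolding r by simp_all
    moreover from this(2) have "sat (M\<lparr>carrier := S\<rparr>) (w(n := x)) p" using u by blast
    ultimately show "sat (M\<lparr>carrier := S\<rparr>) w (Ex n p)" by (simp del: fun_upd_apply) (rule bexI)
  qed
qed

lemma V2_algebra_subalgebra:
  assumes "V2_algebra M" and "S \<subseteq> carrier M"
    and "\<zero>\<^bsub>M\<^esub> \<in> S" "\<one>\<^bsub>M\<^esub> \<in> S"
    and "\<And>x y. x \<in> S \<Longrightarrow> y \<in> S \<Longrightarrow> x \<squnion>\<^bsub>M\<^esub> y \<in> S \<and> x \<sqinter>\<^bsub>M\<^esub> y \<in> S \<and> x \<ominus>\<^bsub>M\<^esub> y \<in> S"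
  shows "V2_algebra (M\<lparr>carrier := S\<rparr>)"
proof -
  interpret V2_algebra M by fact
  note [simp] = assms(3,4,5)
  have [simp]: "x \<in> S \<Longrightarrow> x \<in> carrier M" for x using assms(2) by auto
  have [simp]: "le (M\<lparr>carrier := S\<rparr>) = le M" by (intro ext) (simp add: le_def)
  show ?thesis
  proof (unfold_locales, goal_cases)
    case (6 x y) then show ?case using join_comm[of x y] by simp
  next
    case (7 x y) then show ?case using meet_comm[of x y] by simp
  next
    case (8 x y z) then show ?case using join_assoc[of x y z] by simp
  next
    case (9 x y z) then show ?case using meet_assoc[of x y z] by simp
  qed (simp_all add: join_absorb meet_absorb meet_join_distrib
    bottom_least top_greatest diff_upper diff_least V2_identity)
qed

definition transport :: "('b \<Rightarrow> 'c) \<Rightarrow> ('c \<Rightarrow> 'b) \<Rightarrow> 'b coheyting \<Rightarrow> 'c coheyting" where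
  "transport g h M = \<lparr>carrier = g ` carrier M, bottom = g \<zero>\<^bsub>M\<^esub>, top_elem = g \<one>\<^bsub>M\<^esub>,
    join = (\<lambda>x y. g (h x \<squnion>\<^bsub>M\<^esub> h y)),
    meet = (\<lambda>x y. g (h x \<sqinter>\<^bsub>M\<^esub> h y)),
    diff = (\<lambda>x y. g (h x \<ominus>\<^bsub>M\<^esub> h y))\<rparr>"

lemma transport_sel [simp]:
  "carrier (transport g h M) = g ` carrier M"
  "\<zero>\<^bsub>transport g h M\<^esub> = g \<zero>\<^bsub>M\<^esub>"
  "\<one>\<^bsub>transport g h M\<^esub> = g \<one>\<^bsub>M\<^esub>"
  "x \<squnion>\<^bsub>transport g h M\<^esub> y = g (h x \<squnion>\<^bsub>M\<^esub> h y)"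
  "x \<sqinter>\<^bsub>transport g h M\<^esub> y = g (h x \<sqinter>\<^bsub>M\<^esub> h y)"
  "x \<ominus>\<^bsub>transport g h M\<^esub> y = g (h x \<ominus>\<^bsub>M\<^esub> h y)"
  by (simp_all add: transport_def)

lemma V2_algebra_transport:
  assumes "V2_algebra M" and hg: "\<And>x. x \<in> carrier M \<Longrightarrow> h (g x) = x"
  shows "V2_algebra (transport g h M)"
proof -
  interpret V2_algebra M by fact
  have inj: "g x = g y \<longleftrightarrow> x = y" if "x \<in> carrier M" "y \<in> carrier M" for x y
    using hg that by metis
  have le: "g x \<sqsubseteq>\<^bsub>transport g h M\<^esub> g y \<longleftrightarrow> x \<sqsubseteq>\<^bsub>M\<^esub> y" if "x \<in> carrier M" "y \<in> carrier M" for x y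
    using that by (simp add: le_def hg inj)
  show ?thesis
  proof (unfold_locales, goal_cases)
    case (6 x y) then show ?case by (auto simp: hg join_comm)
  next
    case (7 x y) then show ?case by (auto simp: hg meet_comm)
  next
    case (8 x y z) then show ?case by (auto simp: hg join_assoc)
  next
    case (9 x y z) then show ?case by (auto simp: hg meet_assoc)
  qed (auto simp: hg inj le join_absorb meet_absorb meet_join_distrib
    bottom_least top_greatest diff_upper diff_least V2_identity)
qed

lemma eval_closed:
  assumes "coheyting_algebra M" and "range v \<subseteq> carrier M"
  shows "eval M v t \<in> carrier M"
proof -
  interpret coheyting_algebra M by fact
  show ?thesis using assms(2) by (induction t) (simp_all add: image_subset_iff)
qed

lemma eval_transport:
  assumes "coheyting_algebra M" and hg: "\<And>x. x \<in> carrier M \<Longrightarrow> h (g x) = x"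
    and "range v \<subseteq> carrier M"
  shows "eval (transport g h M) (g \<circ> v) t = g (eval M v t)"
  by (induction t) (simp_all add: hg eval_closed[OF assms(1,3)])

lemma sat_transport:
  assumes "coheyting_algebra M" and hg: "\<And>x. x \<in> carrier M \<Longrightarrow> h (g x) = x"
    and "range v \<subseteq> carrier M"
  shows "sat (transport g h M) (g \<circ> v) p \<longleftrightarrow> sat M v p"
  using assms(3)
proof (induction p arbitrary: v)
  case (Eq s t)
  have "g x = g y \<longleftrightarrow> x = y" if "x \<in> carrier M" "y \<in> carrier M" for x y
    using hg that by metis
  then show ?case
    by (simp del: comp_apply add: eval_transport[where h = h, OF assms(1) hg Eq]
      eval_closed[OF assms(1) Eq])
next
  case (Ex n p)
  have "sat (transport g h M) ((g \<circ> v)(n := g x)) p \<longleftrightarrow> sat M (v(n := x)) p"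
    if "x \<in> carrier M" for x
  proof -
    have "g \<circ> v(n := x) = (g \<circ> v)(n := g x)" by auto
    moreover have "range (v(n := x)) \<subseteq> carrier M" using Ex.prems that by auto
    ultimately show ?thesis using Ex.IH[of "v(n := x)"] by (simp only:)
  qed
  then show ?case by (simp del: comp_apply fun_upd_apply)
qed auto

theorem existentially_closed_V2_any_extension:
  fixes L :: "'a coheyting" and M :: "'b coheyting"
  assumes ec: "existentially_closed_V2 L" and M: "V2_algebra M" and f: "embedding L M f"
    and p: "existential p" and v: "range v \<subseteq> carrier L" and sat: "sat M (f \<circ> v) p"
  shows "sat L v p"
proof -
  interpret L: V2_algebra L using ec by (simp add: existentially_closed_V2_def)
  interpret M: V2_algebra M by fact
  obtain u :: "nat \<Rightarrow> 'b" where u: "range u \<subseteq> carrier M"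
    and usat: "\<And>S. range u \<subseteq> S \<Longrightarrow> sat (M\<lparr>carrier := S\<rparr>) (f \<circ> v) p"
    using existential_witnesses[OF p sat] M.bottom_closed by blast
  define env where "env = case_sum (\<lambda>a. if a \<in> carrier L then f a else \<zero>\<^bsub>M\<^esub>) u"
  have env: "range env \<subseteq> carrier M"
  proof -
    have "env x \<in> carrier M" for x
      using u f by (cases x) (simp_all add: env_def embedding_def image_subset_iff)
    then show ?thesis by blast
  qed
  define S where "S = range (eval M env)"
  define N where "N = M\<lparr>carrier := S\<rparr>"
  define h where "h = eval M env"
  define g where "g = inv_into UNIV h"
  have fS: "f a \<in> S" if "a \<in> carrier L" for a
    using that unfolding S_def by (intro image_eqI[of _ _ "Var (Inl a)"]) (auto simp: env_def)
  have uS: "range u \<subseteq> S"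
  proof -
    have "u n \<in> S" for n
      unfolding S_def by (intro image_eqI[of _ _ "Var (Inr n)"]) (simp_all add: env_def)
    then show ?thesis by blast
  qed
  have hg: "h (g x) = x" if "x \<in> carrier N" for x
    using that by (simp add: N_def S_def g_def h_def f_inv_into_f)
  have N: "V2_algebra N"
    unfolding N_def
  proof (rule V2_algebra_subalgebra[OF M])
    show "S \<subseteq> carrier M"
      unfolding S_def using eval_closed[OF M.coheyting_algebra_axioms env] by blast
    show "\<zero>\<^bsub>M\<^esub> \<in> S" unfolding S_def by (intro image_eqI[of _ _ Zero]) auto
    show "\<one>\<^bsub>M\<^esub> \<in> S" unfolding S_def by (intro image_eqI[of _ _ One]) auto
    fix x y assume "x \<in> S" "y \<in> S"
    then obtain s t where "x = eval M env s" "y = eval M env t" unfolding S_def by blast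
    then have "x \<squnion>\<^bsub>M\<^esub> y = eval M env (Join s t)" "x \<sqinter>\<^bsub>M\<^esub> y = eval M env (Meet s t)"
      "x \<ominus>\<^bsub>M\<^esub> y = eval M env (Diff s t)" by simp_all
    then show "x \<squnion>\<^bsub>M\<^esub> y \<in> S \<and> x \<sqinter>\<^bsub>M\<^esub> y \<in> S \<and> x \<ominus>\<^bsub>M\<^esub> y \<in> S"
      unfolding S_def by (simp only: rangeI simp_thms)
  qed
  interpret N: V2_algebra N by (fact N)
  have fvN: "range (f \<circ> v) \<subseteq> carrier N" using v fS by (simp add: N_def image_subset_iff)
  have "sat N (f \<circ> v) p" unfolding N_def by (rule usat[OF uS])
  then have tsat: "sat (transport g h N) ((g \<circ> f) \<circ> v) p"
    unfolding comp_assoc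
    using sat_transport[where h = h and g = g, OF N.coheyting_algebra_axioms hg fvN] by blast
  have tV2: "V2_algebra (transport g h N)"
    by (rule V2_algebra_transport[where h = h, OF N hg])
  have temb: "embedding L (transport g h N) (g \<circ> f)"
  proof -
    have [simp]: "f a \<in> carrier N" if "a \<in> carrier L" for a using fS that by (simp add: N_def)
    have inj: "inj_on (g \<circ> f) (carrier L)"
    proof (rule inj_onI)
      fix x y assume xy: "x \<in> carrier L" "y \<in> carrier L" "(g \<circ> f) x = (g \<circ> f) y"
      then have "h (g (f x)) = h (g (f y))" by simp
      then have "f x = f y" using xy by (simp add: hg)
      then show "x = y" using f xy by (simp add: embedding_def inj_on_def)
    qed
    show ?thesis
      unfolding embedding_def
    proof (intro conjI ballI)
      show "(g \<circ> f) ` carrier L \<subseteq> carrier (transport g h N)" by auto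
      show "inj_on (g \<circ> f) (carrier L)" by (fact inj)
      show "(g \<circ> f) \<zero>\<^bsub>L\<^esub> = \<zero>\<^bsub>transport g h N\<^esub>" "(g \<circ> f) \<one>\<^bsub>L\<^esub> = \<one>\<^bsub>transport g h N\<^esub>"
        using f by (simp_all add: embedding_def N_def)
      fix x y assume xy: "x \<in> carrier L" "y \<in> carrier L"
      then have "h (g (f x)) = f x" "h (g (f y)) = f y" by (simp_all add: hg)
      then show "(g \<circ> f) (x \<squnion>\<^bsub>L\<^esub> y) = (g \<circ> f) x \<squnion>\<^bsub>transport g h N\<^esub> (g \<circ> f) y"
        "(g \<circ> f) (x \<sqinter>\<^bsub>L\<^esub> y) = (g \<circ> f) x \<sqinter>\<^bsub>transport g h N\<^esub> (g \<circ> f) y"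
        "(g \<circ> f) (x \<ominus>\<^bsub>L\<^esub> y) = (g \<circ> f) x \<ominus>\<^bsub>transport g h N\<^esub> (g \<circ> f) y"
        using f xy by (simp_all add: embedding_def N_def)
    qed
  qed
  show ?thesis
    using ec tV2 temb p v tsat unfolding existentially_closed_V2_def by blast
qed

end

theory Submission
  imports Defs
begin

text \<open>
  An algebra \<open>L\<close> in the variety embeds into the down-sets of its poset of prime ideals, where
  \<open>U \<ominus> V\<close> is the down-closure of \<open>U - V\<close>; the identity of the variety says that each
  principal up-set of prime ideals is directed.  Any preorder \<open>Y\<close> with directed up-sets and a
  surjective p-morphism onto the prime ideals therefore yields an extension of \<open>L\<close>, in which all
  down-sets of \<open>Y\<close> are available as witnesses.  For D2, every prime ideal containing \<open>c\<close> is
  doubled into a two-element chain, and \<open>b\<close> is the lower half of \<open>a\<close>.  For S2, the part of \<open>a\<close>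
  outside \<open>b1\<close> and \<open>b2\<close> is split into two incomparable copies that share only what lies in
  \<open>b1 \<sqinter> b2\<close> below and what lies outside \<open>a\<close> above; the hypothesis on
  \<open>b1 \<sqinter> b2 \<sqinter> (\<one> \<ominus> (\<one> \<ominus> a))\<close> is exactly what keeps the up-sets directed.
\<close>

section \<open>Prime ideals\<close>

context coheyting_algebra
begin

section \<open>The lattice order\<close>

lemma meet_idem: "x \<in> carrier L \<Longrightarrow> x \<sqinter> x = x"
  by (metis join_absorb meet_absorb meet_closed)

lemma le_refl [simp]: "x \<in> carrier L \<Longrightarrow> x \<sqsubseteq> x"
  by (simp add: le_def meet_idem)

lemma le_trans:
  "\<lbrakk>x \<sqsubseteq> y; y \<sqsubseteq> z; x \<in> carrier L; y \<in> carrier L; z \<in> carrier L\<rbrakk> \<Longrightarrow> x \<sqsubseteq> z"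
  unfolding le_def by (metis meet_assoc)

lemma le_antisym: "\<lbrakk>x \<sqsubseteq> y; y \<sqsubseteq> x; x \<in> carrier L; y \<in> carrier L\<rbrakk> \<Longrightarrow> x = y"
  unfolding le_def by (metis meet_comm)

lemma le_join1: "\<lbrakk>x \<in> carrier L; y \<in> carrier L\<rbrakk> \<Longrightarrow> x \<sqsubseteq> x \<squnion> y"
  by (simp add: le_def meet_absorb)

lemma le_join2: "\<lbrakk>x \<in> carrier L; y \<in> carrier L\<rbrakk> \<Longrightarrow> y \<sqsubseteq> x \<squnion> y"
  by (metis join_comm le_join1)

lemma join_least:
  "\<lbrakk>x \<sqsubseteq> z; y \<sqsubseteq> z; x \<in> carrier L; y \<in> carrier L; z \<in> carrier L\<rbrakk> \<Longrightarrow> x \<squnion> y \<sqsubseteq> z"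
  unfolding le_def by (metis join_closed meet_comm meet_join_distrib)

lemma join_mono:
  assumes "x \<sqsubseteq> x'" "y \<sqsubseteq> y'"
    and "x \<in> carrier L" "x' \<in> carrier L" "y \<in> carrier L" "y' \<in> carrier L"
  shows "x \<squnion> y \<sqsubseteq> x' \<squnion> y'"
  using assms by (meson join_closed join_least le_join1 le_join2 le_trans)

lemma meet_le2: "\<lbrakk>x \<in> carrier L; y \<in> carrier L\<rbrakk> \<Longrightarrow> x \<sqinter> y \<sqsubseteq> y"
  by (simp add: le_def meet_assoc meet_idem)

lemma meet_le1: "\<lbrakk>x \<in> carrier L; y \<in> carrier L\<rbrakk> \<Longrightarrow> x \<sqinter> y \<sqsubseteq> x"
  by (metis meet_comm meet_le2)

lemma meet_greatest:
  "\<lbrakk>x \<sqsubseteq> y; x \<sqsubseteq> z; x \<in> carrier L; y \<in> carrier L; z \<in> carrier L\<rbrakk> \<Longrightarrow> x \<sqsubseteq> y \<sqinter> z"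
  unfolding le_def by (metis meet_assoc)

text \<open>Expanding \<open>(k \<squnion> y) \<sqinter> (k \<squnion> z)\<close> by the
  distributivity of meet over join yields the dual law, in the form that primality of a maximal
  ideal uses.\<close>

lemma le_join_meet:
  assumes "x \<sqsubseteq> k \<squnion> y" "x \<sqsubseteq> k \<squnion> z"
    and c: "x \<in> carrier L" "k \<in> carrier L" "y \<in> carrier L" "z \<in> carrier L"
  shows "x \<sqsubseteq> k \<squnion> (y \<sqinter> z)"
proof -
  have "x \<sqsubseteq> (k \<squnion> y) \<sqinter> (k \<squnion> z)" using assms by (simp add: meet_greatest)
  also have "(k \<squnion> y) \<sqinter> (k \<squnion> z) = ((k \<squnion> y) \<sqinter> k) \<squnion> ((k \<squnion> y) \<sqinter> z)"
    using c by (simp add: meet_join_distrib)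
  also have "(k \<squnion> y) \<sqinter> z = (z \<sqinter> k) \<squnion> (z \<sqinter> y)"
    using c by (metis join_closed meet_comm meet_join_distrib)
  also have "z \<sqinter> y = y \<sqinter> z" using c by (simp add: meet_comm)
  finally have 1: "x \<sqsubseteq> ((k \<squnion> y) \<sqinter> k) \<squnion> ((z \<sqinter> k) \<squnion> (y \<sqinter> z))" .
  have "((k \<squnion> y) \<sqinter> k) \<squnion> ((z \<sqinter> k) \<squnion> (y \<sqinter> z)) \<sqsubseteq> k \<squnion> (y \<sqinter> z)"
  proof (rule join_least)
    show "(k \<squnion> y) \<sqinter> k \<sqsubseteq> k \<squnion> (y \<sqinter> z)"
      by (rule le_trans[OF meet_le2 le_join1]) (use c in auto)
    show "(z \<sqinter> k) \<squnion> (y \<sqinter> z) \<sqsubseteq> k \<squnion> (y \<sqinter> z)"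
      by (rule join_mono) (use c in \<open>auto intro: meet_le2\<close>)
  qed (use c in auto)
  then show ?thesis using le_trans[OF 1] c by simp
qed

section \<open>Ideals and the prime ideal theorem\<close>

definition ideal :: "'a set \<Rightarrow> bool" where
  "ideal I \<longleftrightarrow> I \<subseteq> carrier L \<and> \<zero> \<in> I \<and> (\<forall>x\<in>I. \<forall>y\<in>I. x \<squnion> y \<in> I) \<and>
    (\<forall>x\<in>I. \<forall>y\<in>carrier L. y \<sqsubseteq> x \<longrightarrow> y \<in> I)"

text \<open>Properness is required only here, since \<open>ideal_sup\<close> may fill the carrier; a
  one-element algebra has no prime ideals.\<close>

definition prime_ideal :: "'a set \<Rightarrow> bool" where
  "prime_ideal P \<longleftrightarrow> ideal P \<and> \<one> \<notin> P \<and>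
    (\<forall>x\<in>carrier L. \<forall>y\<in>carrier L. x \<sqinter> y \<in> P \<longrightarrow> x \<in> P \<or> y \<in> P)"

definition ideal_sup :: "'a set \<Rightarrow> 'a set \<Rightarrow> 'a set" where
  "ideal_sup I J = {z \<in> carrier L. \<exists>i\<in>I. \<exists>j\<in>J. z \<sqsubseteq> i \<squnion> j}"

lemma ideal_carrier: "\<lbrakk>ideal I; x \<in> I\<rbrakk> \<Longrightarrow> x \<in> carrier L"
  by (auto simp: ideal_def)

lemma ideal_down: "\<lbrakk>ideal I; x \<in> I; y \<sqsubseteq> x; y \<in> carrier L\<rbrakk> \<Longrightarrow> y \<in> I"
  by (auto simp: ideal_def)

lemma ideal_join: "\<lbrakk>ideal I; x \<in> I; y \<in> I\<rbrakk> \<Longrightarrow> x \<squnion> y \<in> I"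
  by (auto simp: ideal_def)

lemma ideal_zero: "ideal I \<Longrightarrow> \<zero> \<in> I"
  by (auto simp: ideal_def)

lemma ideal_principal:
  assumes "b \<in> carrier L"
  shows "ideal {z \<in> carrier L. z \<sqsubseteq> b}"
  unfolding ideal_def using assms by (auto intro: bottom_least join_least le_trans)

lemma ideal_ideal_sup:
  assumes I: "ideal I" and J: "ideal J"
  shows "ideal (ideal_sup I J)"
  unfolding ideal_def
proof (intro conjI ballI impI)
  show "ideal_sup I J \<subseteq> carrier L" by (auto simp: ideal_sup_def)
  show "\<zero> \<in> ideal_sup I J"
    using ideal_zero[OF I] ideal_zero[OF J] bottom_least[of "\<zero> \<squnion> \<zero>"] bottom_closed
    by (auto simp: ideal_sup_def intro!: bexI[of _ \<zero>] bottom_least)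
next
  fix x y assume "x \<in> ideal_sup I J" "y \<in> ideal_sup I J"
  then obtain i j i' j' where *: "i \<in> I" "j \<in> J" "i' \<in> I" "j' \<in> J"
    "x \<sqsubseteq> i \<squnion> j" "y \<sqsubseteq> i' \<squnion> j'" and xy: "x \<in> carrier L" "y \<in> carrier L"
    by (auto simp: ideal_sup_def)
  note c = ideal_carrier[OF I *(1)] ideal_carrier[OF J *(2)]
    ideal_carrier[OF I *(3)] ideal_carrier[OF J *(4)]
  have "i \<squnion> j \<sqsubseteq> (i \<squnion> i') \<squnion> (j \<squnion> j')" "i' \<squnion> j' \<sqsubseteq> (i \<squnion> i') \<squnion> (j \<squnion> j')"
    by (rule join_mono; use c in \<open>auto intro: le_join1 le_join2\<close>)+
  then have "x \<sqsubseteq> (i \<squnion> i') \<squnion> (j \<squnion> j')" "y \<sqsubseteq> (i \<squnion> i') \<squnion> (j \<squnion> j')"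
    using le_trans[OF *(5)] le_trans[OF *(6)] c xy by auto
  then have "x \<squnion> y \<sqsubseteq> (i \<squnion> i') \<squnion> (j \<squnion> j')" using c xy by (simp add: join_least)
  then show "x \<squnion> y \<in> ideal_sup I J"
    using xy ideal_join[OF I *(1,3)] ideal_join[OF J *(2,4)] by (auto simp: ideal_sup_def)
next
  fix x y assume "x \<in> ideal_sup I J" and y: "y \<in> carrier L" "y \<sqsubseteq> x"
  then obtain i j where "i \<in> I" "j \<in> J" "x \<sqsubseteq> i \<squnion> j" "x \<in> carrier L"
    by (auto simp: ideal_sup_def)
  moreover from this have "y \<sqsubseteq> i \<squnion> j"
    using y le_trans[OF y(2)] ideal_carrier[OF I] ideal_carrier[OF J] by simp
  ultimately show "y \<in> ideal_sup I J" using y by (auto simp: ideal_sup_def)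
qed

lemma ideal_sup_upper1: "\<lbrakk>ideal I; ideal J\<rbrakk> \<Longrightarrow> I \<subseteq> ideal_sup I J"
  unfolding ideal_sup_def using ideal_zero[of J] ideal_carrier[of I] le_join1[OF _ bottom_closed]
  by blast

lemma ideal_sup_upper2: "\<lbrakk>ideal I; ideal J\<rbrakk> \<Longrightarrow> J \<subseteq> ideal_sup I J"
  unfolding ideal_sup_def using ideal_zero[of I] ideal_carrier[of J] le_join2[OF bottom_closed]
  by blast

text \<open>Zorn's lemma gives an ideal maximal among those that contain \<open>I\<close> and miss
  \<open>a\<close>; distributivity makes it prime.\<close>

lemma prime_ideal_exists:
  assumes I: "ideal I" and a: "a \<in> carrier L" "a \<notin> I"
  obtains P where "prime_ideal P" "I \<subseteq> P" "a \<notin> P"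
proof -
  define \<A> where "\<A> = {J. ideal J \<and> I \<subseteq> J \<and> a \<notin> J}"
  have "\<exists>P\<in>\<A>. \<forall>J\<in>\<A>. P \<subseteq> J \<longrightarrow> J = P"
  proof (rule subset_Zorn_nonempty)
    show "\<A> \<noteq> {}" using I a by (auto simp: \<A>_def)
    fix \<C> assume ne: "\<C> \<noteq> {}" and ch: "subset.chain \<A> \<C>"
    then have sub: "\<C> \<subseteq> \<A>" by (auto simp: subset.chain_def)
    have "ideal (\<Union>\<C>)"
      unfolding ideal_def
    proof (intro conjI ballI impI)
      show "\<Union>\<C> \<subseteq> carrier L" using sub by (auto simp: \<A>_def ideal_def)
      show "\<zero> \<in> \<Union>\<C>" using sub ne by (auto simp: \<A>_def ideal_def)
    next
      fix x y assume "x \<in> \<Union>\<C>" "y \<in> \<Union>\<C>"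
      then obtain J K where JK: "x \<in> J" "y \<in> K" "J \<in> \<C>" "K \<in> \<C>" by auto
      then have "J \<subseteq> K \<or> K \<subseteq> J" using ch by (auto simp: subset.chain_def)
      then obtain M where "x \<in> M" "y \<in> M" "M \<in> \<C>" using JK by blast
      then show "x \<squnion> y \<in> \<Union>\<C>" using sub by (auto simp: \<A>_def intro: ideal_join)
    next
      fix x y assume "x \<in> \<Union>\<C>" "y \<in> carrier L" "y \<sqsubseteq> x"
      then show "y \<in> \<Union>\<C>" using sub by (auto simp: \<A>_def intro: ideal_down)
    qed
    then show "\<Union>\<C> \<in> \<A>" using sub ne by (auto simp: \<A>_def)
  qed
  then obtain P where "P \<in> \<A>" and max: "\<And>J. \<lbrakk>J \<in> \<A>; P \<subseteq> J\<rbrakk> \<Longrightarrow> J = P" by blast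
  then have P: "ideal P" "I \<subseteq> P" "a \<notin> P" by (auto simp: \<A>_def)
  \<comment> \<open>By maximality the ideal generated by \<open>P\<close> and \<open>x\<close>
    contains \<open>a\<close>.\<close>
  have ext: "\<exists>p\<in>P. a \<sqsubseteq> p \<squnion> x" if x: "x \<in> carrier L" "x \<notin> P" for x
  proof (rule ccontr)
    let ?X = "{z \<in> carrier L. z \<sqsubseteq> x}"
    let ?J = "ideal_sup P ?X"
    assume none: "\<not> ?thesis"
    have X: "ideal ?X" by (rule ideal_principal[OF x(1)])
    have "a \<notin> ?J"
    proof
      assume "a \<in> ?J"
      then obtain p z where "p \<in> P" "z \<in> carrier L" "z \<sqsubseteq> x" and az: "a \<sqsubseteq> p \<squnion> z"
        by (auto simp: ideal_sup_def)
      moreover from this have "p \<squnion> z \<sqsubseteq> p \<squnion> x"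
        using x ideal_carrier[OF P(1)] by (simp add: join_mono)
      ultimately have "a \<sqsubseteq> p \<squnion> x"
        using a x ideal_carrier[OF P(1)] by (simp add: le_trans[OF az])
      then show False using none \<open>p \<in> P\<close> by blast
    qed
    then have "?J = P"
      using max[of ?J] ideal_sup_upper1[OF P(1) X] ideal_ideal_sup[OF P(1) X] P
      by (auto simp: \<A>_def)
    then show False using ideal_sup_upper2[OF P(1) X] x by auto
  qed
  have "prime_ideal P"
    unfolding prime_ideal_def
  proof (intro conjI ballI impI)
    show "\<one> \<notin> P" using P(3) ideal_down[OF P(1) _ top_greatest[OF a(1)] a(1)] by blast
    fix x y assume xy: "x \<in> carrier L" "y \<in> carrier L" "x \<sqinter> y \<in> P"
    show "x \<in> P \<or> y \<in> P"
    proof (rule ccontr)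
      assume "\<not> ?thesis"
      then obtain p q where pq: "p \<in> P" "q \<in> P" "a \<sqsubseteq> p \<squnion> x" "a \<sqsubseteq> q \<squnion> y"
        using ext[of x] ext[of y] xy by blast
      note c = ideal_carrier[OF P(1) pq(1)] ideal_carrier[OF P(1) pq(2)]
      \<comment> \<open>Enlarging \<open>p\<close> and \<open>q\<close> to
        \<open>p \<squnion> q\<close> lets \<open>le_join_meet\<close> combine the two bounds on
        \<open>a\<close>.\<close>
      have "p \<squnion> x \<sqsubseteq> (p \<squnion> q) \<squnion> x" "q \<squnion> y \<sqsubseteq> (p \<squnion> q) \<squnion> y"
        using c xy by (auto intro: join_mono le_join1 le_join2)
      then have "a \<sqsubseteq> (p \<squnion> q) \<squnion> x" "a \<sqsubseteq> (p \<squnion> q) \<squnion> y"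
        using le_trans[OF pq(3)] le_trans[OF pq(4)] c a xy by auto
      then have "a \<sqsubseteq> (p \<squnion> q) \<squnion> (x \<sqinter> y)" using c a xy by (simp add: le_join_meet)
      moreover have "(p \<squnion> q) \<squnion> (x \<sqinter> y) \<in> P"
        using ideal_join[OF P(1)] pq xy by simp
      ultimately have "a \<in> P" using ideal_down[OF P(1)] a by simp
      then show False using P by simp
    qed
  qed (rule P)
  then show thesis using that P by blast
qed

section \<open>The operations read off from prime ideals\<close>

lemma prime_ideal_join_iff:
  assumes "prime_ideal P" "x \<in> carrier L" "y \<in> carrier L"
  shows "x \<squnion> y \<in> P \<longleftrightarrow> x \<in> P \<and> y \<in> P"
  using assms ideal_join ideal_down le_join1 le_join2 unfolding prime_ideal_def by metis

lemma prime_ideal_meet_iff: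
  assumes "prime_ideal P" "x \<in> carrier L" "y \<in> carrier L"
  shows "x \<sqinter> y \<in> P \<longleftrightarrow> x \<in> P \<or> y \<in> P"
  using assms ideal_down meet_le1 meet_le2 meet_closed unfolding prime_ideal_def by metis

text \<open>Forwards, \<open>x\<close> is separated from the ideal generated by \<open>y\<close> and
  \<open>P\<close>: a bound \<open>x \<sqsubseteq> y \<squnion> p\<close> with
  \<open>p \<in> P\<close> would put \<open>x \<ominus> y\<close> into \<open>P\<close>. Backwards,
  if \<open>x \<ominus> y\<close> were in \<open>P\<close>, then
  \<open>x \<sqsubseteq> y \<squnion> (x \<ominus> y)\<close> would put \<open>x\<close> into
  \<open>Q\<close>.\<close>

lemma prime_ideal_diff_iff:
  assumes P: "prime_ideal P" and x: "x \<in> carrier L" and y: "y \<in> carrier L"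
  shows "x \<ominus> y \<notin> P \<longleftrightarrow> (\<exists>Q. prime_ideal Q \<and> P \<subseteq> Q \<and> x \<notin> Q \<and> y \<in> Q)"
proof
  have iP: "ideal P" using P by (simp add: prime_ideal_def)
  let ?Y = "{z \<in> carrier L. z \<sqsubseteq> y}"
  have iY: "ideal ?Y" by (rule ideal_principal[OF y])
  assume d: "x \<ominus> y \<notin> P"
  have "x \<notin> ideal_sup ?Y P"
  proof
    assume "x \<in> ideal_sup ?Y P"
    then obtain z p where zp: "z \<in> carrier L" "z \<sqsubseteq> y" "p \<in> P" "x \<sqsubseteq> z \<squnion> p"
      by (auto simp: ideal_sup_def)
    note p = ideal_carrier[OF iP zp(3)]
    have "z \<squnion> p \<sqsubseteq> y \<squnion> p" using zp y p by (simp add: join_mono)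
    then have "x \<sqsubseteq> y \<squnion> p" using le_trans[OF zp(4)] zp x y p by simp
    then have "x \<ominus> y \<sqsubseteq> p" using x y p by (simp add: diff_least)
    then show False using d ideal_down[OF iP zp(3)] x y by simp
  qed
  from prime_ideal_exists[OF ideal_ideal_sup[OF iY iP] x this]
  obtain Q where "prime_ideal Q" "ideal_sup ?Y P \<subseteq> Q" "x \<notin> Q" .
  moreover have "y \<in> ideal_sup ?Y P" "P \<subseteq> ideal_sup ?Y P"
    using ideal_sup_upper1[OF iY iP] ideal_sup_upper2[OF iY iP] y by auto
  ultimately show "\<exists>Q. prime_ideal Q \<and> P \<subseteq> Q \<and> x \<notin> Q \<and> y \<in> Q" by blast
next
  assume "\<exists>Q. prime_ideal Q \<and> P \<subseteq> Q \<and> x \<notin> Q \<and> y \<in> Q"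
  then obtain Q where Q: "ideal Q" "P \<subseteq> Q" "x \<notin> Q" "y \<in> Q" by (auto simp: prime_ideal_def)
  then show "x \<ominus> y \<notin> P"
    using ideal_join[OF Q(1)] ideal_down[OF Q(1) _ diff_upper[OF x y] x] by blast
qed

text \<open>If \<open>u \<sqsubseteq> w\<close> fails, some prime ideal contains the principal ideal
  of \<open>w\<close> and misses \<open>u\<close>.\<close>

lemma prime_ideals_separate:
  assumes x: "x \<in> carrier L" and y: "y \<in> carrier L"
    and same: "\<And>P. prime_ideal P \<Longrightarrow> x \<in> P \<longleftrightarrow> y \<in> P"
  shows "x = y"
proof -
  have "u \<sqsubseteq> w" if u: "u \<in> carrier L" and w: "w \<in> carrier L"
    and "\<And>P. prime_ideal P \<Longrightarrow> u \<in> P \<longleftrightarrow> w \<in> P" for u w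
  proof (rule ccontr)
    assume "\<not> u \<sqsubseteq> w"
    then have "u \<notin> {z \<in> carrier L. z \<sqsubseteq> w}" by simp
    from prime_ideal_exists[OF ideal_principal[OF w] u this]
    obtain P where "prime_ideal P" "{z \<in> carrier L. z \<sqsubseteq> w} \<subseteq> P" "u \<notin> P" .
    then show False using that w by auto
  qed
  from this[of x y] this[of y x] show ?thesis using assms by (simp add: le_antisym)
qed

end

text \<open>It suffices that \<open>Q\<close> and \<open>R\<close> generate a proper ideal.
  Otherwise \<open>\<one> \<sqsubseteq> q \<squnion> r\<close>, so
  \<open>\<one> \<ominus> q \<sqsubseteq> r\<close>, while the identity puts
  \<open>\<one> \<ominus> q\<close> or \<open>\<one> \<ominus> (\<one> \<ominus> q)\<close> into
  \<open>P\<close>; the first forces \<open>\<one>\<close> into \<open>Q\<close>, the second into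
  \<open>R\<close>.\<close>

lemma (in V2_algebra) prime_ideals_directed:
  assumes "prime_ideal P" "prime_ideal Q" "prime_ideal R" "P \<subseteq> Q" "P \<subseteq> R"
  obtains S where "prime_ideal S" "Q \<subseteq> S" "R \<subseteq> S"
proof -
  have iQ: "ideal Q" and iR: "ideal R" and nQ: "\<one> \<notin> Q" and nR: "\<one> \<notin> R"
    using assms by (auto simp: prime_ideal_def)
  have "\<one> \<notin> ideal_sup Q R"
  proof
    assume "\<one> \<in> ideal_sup Q R"
    then obtain q r where qr: "q \<in> Q" "r \<in> R" "\<one> \<sqsubseteq> q \<squnion> r" by (auto simp: ideal_sup_def)
    note c = ideal_carrier[OF iQ qr(1)] ideal_carrier[OF iR qr(2)]
    have proper: "x \<squnion> (\<one> \<ominus> x) \<notin> I" if "ideal I" "\<one> \<notin> I" "x \<in> carrier L" for x I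
      using that ideal_down[OF that(1) _ diff_upper[OF top_closed that(3)]] by auto
    have "(\<one> \<ominus> q) \<sqinter> (\<one> \<ominus> (\<one> \<ominus> q)) \<in> P"
      using V2_identity c(1) assms(1) ideal_zero by (simp add: prime_ideal_def)
    then consider "\<one> \<ominus> q \<in> P" | "\<one> \<ominus> (\<one> \<ominus> q) \<in> P"
      using prime_ideal_meet_iff[OF assms(1)] c(1) by auto
    then show False
    proof cases
      case 1
      then have "q \<squnion> (\<one> \<ominus> q) \<in> Q" using ideal_join[OF iQ qr(1)] assms(4) by auto
      then show False using proper[OF iQ nQ c(1)] by simp
    next
      case 2
      have "\<one> \<ominus> q \<in> R" using ideal_down[OF iR qr(2) diff_least] qr c by simp
      moreover have "\<one> \<ominus> (\<one> \<ominus> q) \<in> R" using 2 assms(5) by auto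
      ultimately have "(\<one> \<ominus> q) \<squnion> (\<one> \<ominus> (\<one> \<ominus> q)) \<in> R" by (rule ideal_join[OF iR])
      then show False using proper[OF iR nR, of "\<one> \<ominus> q"] c(1) by simp
    qed
  qed
  from prime_ideal_exists[OF ideal_ideal_sup[OF iQ iR] top_closed this]
  obtain S where "prime_ideal S" "ideal_sup Q R \<subseteq> S" "\<one> \<notin> S" .
  then show thesis using that[of S] ideal_sup_upper1[OF iQ iR] ideal_sup_upper2[OF iQ iR] by blast
qed

section \<open>Down-sets of a preorder\<close>

definition downset_algebra :: "'b set \<Rightarrow> ('b \<Rightarrow> 'b \<Rightarrow> bool) \<Rightarrow> 'b set coheyting" where
  "downset_algebra Y r = \<lparr>
    carrier = {U. U \<subseteq> Y \<and> (\<forall>y\<in>U. \<forall>x\<in>Y. r x y \<longrightarrow> x \<in> U)},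
    bottom = {}, top_elem = Y, join = (\<union>), meet = (\<inter>),
    diff = (\<lambda>U V. {x \<in> Y. \<exists>y\<in>U - V. r x y})\<rparr>"

lemma downset_algebra_sel [simp]:
  "carrier (downset_algebra Y r) = {U. U \<subseteq> Y \<and> (\<forall>y\<in>U. \<forall>x\<in>Y. r x y \<longrightarrow> x \<in> U)}"
  "\<zero>\<^bsub>downset_algebra Y r\<^esub> = {}"
  "\<one>\<^bsub>downset_algebra Y r\<^esub> = Y"
  "U \<squnion>\<^bsub>downset_algebra Y r\<^esub> V = U \<union> V"
  "U \<sqinter>\<^bsub>downset_algebra Y r\<^esub> V = U \<inter> V"
  "U \<ominus>\<^bsub>downset_algebra Y r\<^esub> V = {x \<in> Y. \<exists>y\<in>U - V. r x y}"
  by (simp_all add: downset_algebra_def)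

lemma le_downset_algebra [simp]: "U \<sqsubseteq>\<^bsub>downset_algebra Y r\<^esub> V \<longleftrightarrow> U \<subseteq> V"
  by (auto simp: le_def)

text \<open>Only points with a common lower bound must have a common upper bound; this is the
  condition on \<open>r\<close> that matches the identity of the variety.\<close>

locale updirected_preorder =
  fixes Y :: "'b set" and r :: "'b \<Rightarrow> 'b \<Rightarrow> bool"
  assumes refl: "x \<in> Y \<Longrightarrow> r x x"
    and trans: "\<lbrakk>x \<in> Y; y \<in> Y; z \<in> Y; r x y; r y z\<rbrakk> \<Longrightarrow> r x z"
    and directed: "\<lbrakk>x \<in> Y; y \<in> Y; z \<in> Y; r x y; r x z\<rbrakk> \<Longrightarrow> \<exists>w\<in>Y. r y w \<and> r z w"
begin

text \<open>Transitivity makes each difference a down-set, reflexivity gives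
  \<open>diff_upper\<close>, and directedness gives the identity.\<close>

lemma V2_downset_algebra: "V2_algebra (downset_algebra Y r)"
proof (unfold_locales, goal_cases)
  case (5 U V)
  have "r x z" if "x \<in> Y" "y \<in> Y" "z \<in> U" "r x y" "r y z" for x y z
    using trans[of x y z] that 5 by auto
  then show ?case by auto
next
  case (15 U V)
  then show ?case using refl by auto
next
  case (17 U)
  \<comment> \<open>A common upper bound of \<open>y\<close> and \<open>z\<close> stays outside the
    down-set \<open>U\<close> because \<open>y\<close> does, so \<open>z\<close> lies in the
    down-closure of \<open>Y - U\<close>.\<close>
  have "\<exists>w\<in>Y - U. r z w" if xyz: "x \<in> Y" "y \<in> Y" "z \<in> Y" "r x y" "r x z" and y: "y \<notin> U"
    for x y z
  proof -
    obtain w where w: "w \<in> Y" "r y w" "r z w" using directed[OF xyz] by blast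
    then have "w \<notin> U" using 17 xyz y by auto
    then show ?thesis using w by blast
  qed
  then show ?case by auto
qed auto

end

section \<open>Extensions from p-morphisms\<close>

text \<open>\<open>mono\<close> and \<open>lift\<close> are the forth and back conditions of a
  p-morphism onto the prime ideals ordered by inclusion.\<close>

locale prime_ideal_cover = V2_algebra L + updirected_preorder Y r
  for L :: "'a coheyting" (structure) and Y :: "'b set" and r +
  fixes f :: "'b \<Rightarrow> 'a set"
  assumes prime: "y \<in> Y \<Longrightarrow> prime_ideal (f y)"
    and surj: "prime_ideal P \<Longrightarrow> \<exists>y\<in>Y. f y = P"
    and mono: "\<lbrakk>x \<in> Y; y \<in> Y; r x y\<rbrakk> \<Longrightarrow> f x \<subseteq> f y"
    and lift: "\<lbrakk>x \<in> Y; prime_ideal Q; f x \<subseteq> Q\<rbrakk> \<Longrightarrow> \<exists>y\<in>Y. r x y \<and> f y = Q"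
begin

text \<open>Omission rather than membership, because it passes to smaller ideals and so gives a
  down-set.\<close>

definition rep :: "'a \<Rightarrow> 'b set" where
  "rep a = {y \<in> Y. a \<notin> f y}"

text \<open>Separation by prime ideals gives injectivity, primality handles join and meet. For
  \<open>\<ominus>\<close>, \<open>lift\<close> turns the ideal of
  \<open>prime_ideal_diff_iff\<close> into a point of \<open>Y\<close>, and \<open>mono\<close>
  gives the converse.\<close>

lemma embedding_rep: "embedding L (downset_algebra Y r) rep"
  unfolding embedding_def
proof (intro conjI ballI)
  show "rep ` carrier L \<subseteq> carrier (downset_algebra Y r)"
    using mono by (auto simp: rep_def)
  show "inj_on rep (carrier L)"
  proof (rule inj_onI)
    fix a b assume ab: "a \<in> carrier L" "b \<in> carrier L" and eq: "rep a = rep b"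
    show "a = b"
    proof (rule prime_ideals_separate[OF ab])
      fix P assume "prime_ideal P"
      then obtain y where "y \<in> Y" "f y = P" using surj by blast
      then show "a \<in> P \<longleftrightarrow> b \<in> P" using eq by (auto simp: rep_def)
    qed
  qed
  show "rep \<zero> = \<zero>\<^bsub>downset_algebra Y r\<^esub>" "rep \<one> = \<one>\<^bsub>downset_algebra Y r\<^esub>"
    using prime by (auto simp: rep_def prime_ideal_def ideal_def)
  fix a b assume ab: "a \<in> carrier L" "b \<in> carrier L"
  show "rep (a \<squnion> b) = rep a \<squnion>\<^bsub>downset_algebra Y r\<^esub> rep b"
    "rep (a \<sqinter> b) = rep a \<sqinter>\<^bsub>downset_algebra Y r\<^esub> rep b"
    using prime ab by (auto simp: rep_def prime_ideal_join_iff prime_ideal_meet_iff)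
  have "a \<ominus> b \<notin> f x \<longleftrightarrow> (\<exists>y\<in>rep a - rep b. r x y)" if x: "x \<in> Y" for x
  proof -
    have "(\<exists>Q. prime_ideal Q \<and> f x \<subseteq> Q \<and> a \<notin> Q \<and> b \<in> Q) \<longleftrightarrow>
        (\<exists>y\<in>Y. r x y \<and> a \<notin> f y \<and> b \<in> f y)"
    proof (intro iffI; elim exE bexE conjE)
      fix Q assume "prime_ideal Q" "f x \<subseteq> Q" "a \<notin> Q" "b \<in> Q"
      then show "\<exists>y\<in>Y. r x y \<and> a \<notin> f y \<and> b \<in> f y" using lift[OF x] by blast
    next
      fix y assume "y \<in> Y" "r x y" "a \<notin> f y" "b \<in> f y"
      then show "\<exists>Q. prime_ideal Q \<and> f x \<subseteq> Q \<and> a \<notin> Q \<and> b \<in> Q"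
        using prime mono[OF x] by blast
    qed
    then show ?thesis
      unfolding prime_ideal_diff_iff[OF prime[OF x] ab] by (auto simp: rep_def)
  qed
  then show "rep (a \<ominus> b) = rep a \<ominus>\<^bsub>downset_algebra Y r\<^esub> rep b"
    by (auto simp: rep_def)
qed

end

section \<open>Density and splitting\<close>

text \<open>With \<open>\<lless>\<close> unfolded into equations, the existence of \<open>b\<close>
  is an existential formula with parameters \<open>a\<close> and \<open>c\<close>, so it descends
  from \<open>M\<close> to \<open>L\<close>.\<close>

lemma existentially_closed_V2_pull_dense:
  fixes L :: "'a coheyting" and M :: "'b coheyting"
  assumes ec: "existentially_closed_V2 L" and M: "V2_algebra M" and f: "embedding L M f"
    and ac: "a \<in> carrier L" "c \<in> carrier L"
    and b: "b \<in> carrier M" "b \<noteq> \<zero>\<^bsub>M\<^esub>" "f c \<lless>\<^bsub>M\<^esub> b" "b \<lless>\<^bsub>M\<^esub> f a"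
  shows "\<exists>b\<in>carrier L. b \<noteq> \<zero>\<^bsub>L\<^esub> \<and> c \<lless>\<^bsub>L\<^esub> b \<and> b \<lless>\<^bsub>L\<^esub> a"
proof -
  \<comment> \<open>Variables 0 and 1 carry the parameters and 2 is bound to the witness; the
    default \<open>c\<close> elsewhere keeps the range of \<open>v\<close> inside
    \<open>L\<close>.\<close>
  define v where "v = (\<lambda>n::nat. if n = 0 then a else c)"
  let ?p = "Ex 2 (And (Neg (Eq (Var 2) Zero))
    (And (And (Eq (Diff (Var 2) (Var 1)) (Var 2)) (Eq (Meet (Var 1) (Var 2)) (Var 1)))
         (And (Eq (Diff (Var 0) (Var 2)) (Var 0)) (Eq (Meet (Var 2) (Var 0)) (Var 2)))))"
  have "sat L v ?p"
  proof (rule existentially_closed_V2_any_extension[OF ec M f])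
    show "existential ?p" by (intro existential.intros) simp
    show "range v \<subseteq> carrier L" using ac by (auto simp: v_def)
    have "sat M ((f \<circ> v)(2 := b)) (And (Neg (Eq (Var 2) Zero))
    (And (And (Eq (Diff (Var 2) (Var 1)) (Var 2)) (Eq (Meet (Var 1) (Var 2)) (Var 1)))
         (And (Eq (Diff (Var 0) (Var 2)) (Var 0)) (Eq (Meet (Var 2) (Var 0)) (Var 2)))))"
      using b by (simp add: v_def strongly_below_def le_def)
    then show "sat M (f \<circ> v) ?p"
      unfolding sat.simps(5) using b(1) by blast
  qed
  then show ?thesis by (auto simp: v_def strongly_below_def le_def)
qed

text \<open>The same transfer for S2, with parameters at the variables 0, 1, 2 and witnesses at 3
  and 4.\<close>

lemma existentially_closed_V2_pull_splitting:
  fixes L :: "'a coheyting" and M :: "'b coheyting"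
  assumes ec: "existentially_closed_V2 L" and M: "V2_algebra M" and f: "embedding L M f"
    and ab: "a \<in> carrier L" "b1 \<in> carrier L" "b2 \<in> carrier L"
    and a1: "a1 \<in> carrier M" "a1 \<noteq> \<zero>\<^bsub>M\<^esub>" "f a \<ominus>\<^bsub>M\<^esub> a2 = a1" "f b1 \<sqsubseteq>\<^bsub>M\<^esub> a1"
    and a2: "a2 \<in> carrier M" "a2 \<noteq> \<zero>\<^bsub>M\<^esub>" "f a \<ominus>\<^bsub>M\<^esub> a1 = a2" "f b2 \<sqsubseteq>\<^bsub>M\<^esub> a2"
    and a12: "a1 \<sqinter>\<^bsub>M\<^esub> a2 = f b1 \<sqinter>\<^bsub>M\<^esub> f b2"
  shows "\<exists>a1\<in>carrier L. \<exists>a2\<in>carrier L. a1 \<noteq> \<zero>\<^bsub>L\<^esub> \<and> a2 \<noteq> \<zero>\<^bsub>L\<^esub> \<and>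
    a \<ominus>\<^bsub>L\<^esub> a2 = a1 \<and> b1 \<sqsubseteq>\<^bsub>L\<^esub> a1 \<and> a \<ominus>\<^bsub>L\<^esub> a1 = a2 \<and> b2 \<sqsubseteq>\<^bsub>L\<^esub> a2 \<and>
    a1 \<sqinter>\<^bsub>L\<^esub> a2 = b1 \<sqinter>\<^bsub>L\<^esub> b2"
proof -
  define v where "v = (\<lambda>n::nat. if n = 0 then a else if n = 1 then b1 else b2)"
  let ?p = "Ex 3 (Ex 4 (And (Neg (Eq (Var 3) Zero)) (And (Neg (Eq (Var 4) Zero))
    (And (And (Eq (Diff (Var 0) (Var 4)) (Var 3)) (Eq (Meet (Var 1) (Var 3)) (Var 1)))
    (And (And (Eq (Diff (Var 0) (Var 3)) (Var 4)) (Eq (Meet (Var 2) (Var 4)) (Var 2)))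
         (Eq (Meet (Var 3) (Var 4)) (Meet (Var 1) (Var 2))))))))"
  have "sat L v ?p"
  proof (rule existentially_closed_V2_any_extension[OF ec M f])
    show "existential ?p" by (intro existential.intros) simp
    show "range v \<subseteq> carrier L" using ab by (auto simp: v_def)
    have "sat M ((f \<circ> v)(3 := a1, 4 := a2))
        (And (Neg (Eq (Var 3) Zero)) (And (Neg (Eq (Var 4) Zero))
    (And (And (Eq (Diff (Var 0) (Var 4)) (Var 3)) (Eq (Meet (Var 1) (Var 3)) (Var 1)))
    (And (And (Eq (Diff (Var 0) (Var 3)) (Var 4)) (Eq (Meet (Var 2) (Var 4)) (Var 2)))
         (Eq (Meet (Var 3) (Var 4)) (Meet (Var 1) (Var 2)))))))"
      using a1 a2 a12 by (simp add: v_def le_def)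
    then show "sat M (f \<circ> v) ?p"
      unfolding sat.simps(5) using a1(1) a2(1) by blast
  qed
  then show ?thesis by (auto simp: v_def le_def)
qed

section \<open>Density: doubling into chains\<close>

lemma existentially_closed_V2_density:
  assumes ec: "existentially_closed_V2 L"
  shows "axiom_D2 L"
  unfolding axiom_D2_def
proof (intro ballI impI, elim conjE)
  fix a c
  assume a: "a \<in> carrier L" and c: "c \<in> carrier L"
    and ca: "c \<lless>\<^bsub>L\<^esub> a" and a0: "a \<noteq> \<zero>\<^bsub>L\<^esub>"
  interpret V2_algebra L using ec by (simp add: existentially_closed_V2_def)
  \<comment> \<open>\<open>False\<close> marks the lower copy. An ideal omitting \<open>c\<close>
    has only this one, which puts \<open>rep c\<close> inside \<open>?b\<close>.\<close>
  let ?Y = "{(P, i). prime_ideal P \<and> (i \<longrightarrow> c \<in> P)}"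
  let ?r = "\<lambda>(P, i) (Q, j). P \<subseteq> Q \<and> (i \<longrightarrow> j)"
  interpret prime_ideal_cover L ?Y ?r fst
  proof (unfold_locales, goal_cases)
    case (3 x y z)
    obtain P i Q j R k where eq: "x = (P, i)" "y = (Q, j)" "z = (R, k)" by (metis prod.exhaust)
    with 3 obtain S where "prime_ideal S" "Q \<subseteq> S" "R \<subseteq> S"
      using prime_ideals_directed[of P Q R] by auto
    \<comment> \<open>If \<open>j\<close> or \<open>k\<close> holds, then \<open>c\<close> lies in
      \<open>Q\<close> or \<open>R\<close>, hence in \<open>S\<close>, so this point belongs to
      \<open>?Y\<close>.\<close>
    then show ?case using 3 by (intro bexI[of _ "(S, j \<or> k)"]) (auto simp: eq)
  next
    case (7 x Q)
    then show ?case by (intro bexI[of _ "(Q, snd x)"]) auto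
  qed auto
  have diff: "\<exists>Q. prime_ideal Q \<and> P \<subseteq> Q \<and> a \<notin> Q \<and> c \<in> Q" if "prime_ideal P" "a \<notin> P" for P
    using prime_ideal_diff_iff[OF that(1) a c] ca that by (simp add: strongly_below_def)
  have sub: "c \<in> P" if "prime_ideal P" "a \<in> P" for P
    using ca c that by (auto simp: strongly_below_def prime_ideal_def intro: ideal_down)
  have pos: "\<exists>P. prime_ideal P \<and> a \<notin> P"
    using prime_ideals_separate[OF a bottom_closed] a0 ideal_zero by (auto simp: prime_ideal_def)
  let ?b = "{(P, i). prime_ideal P \<and> a \<notin> P \<and> \<not> i}"
  show "\<exists>b\<in>carrier L. b \<noteq> \<zero>\<^bsub>L\<^esub> \<and> c \<lless>\<^bsub>L\<^esub> b \<and> b \<lless>\<^bsub>L\<^esub> a"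
  proof (rule existentially_closed_V2_pull_dense[OF ec V2_downset_algebra embedding_rep a c])
    show "?b \<in> carrier (downset_algebra ?Y ?r)" by auto
    show "?b \<noteq> \<zero>\<^bsub>downset_algebra ?Y ?r\<^esub>" using pos by auto
    have "{x \<in> ?Y. \<exists>y\<in>?b - rep c. ?r x y} = ?b"
    proof (intro equalityI subsetI)
      \<comment> \<open>The point above \<open>x\<close> is the lower copy of \<open>Q\<close>; it
        avoids \<open>rep c\<close> since \<open>c \<in> Q\<close>.\<close>
      fix x assume x: "x \<in> ?b"
      then obtain Q where "prime_ideal Q" "fst x \<subseteq> Q" "a \<notin> Q" "c \<in> Q"
        using diff[of "fst x"] by auto
      with x show "x \<in> {x \<in> ?Y. \<exists>y\<in>?b - rep c. ?r x y}"
        by (auto simp: rep_def intro!: bexI[of _ "(Q, False)"])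
    qed auto
    moreover have "rep c \<subseteq> ?b" using sub by (auto simp: rep_def)
    ultimately show "rep c \<lless>\<^bsub>downset_algebra ?Y ?r\<^esub> ?b"
      unfolding strongly_below_def le_downset_algebra downset_algebra_sel by blast
    have "{x \<in> ?Y. \<exists>y\<in>rep a - ?b. ?r x y} = rep a"
    proof (intro equalityI subsetI)
      \<comment> \<open>Now the upper copy of \<open>Q\<close> is taken; it exists since
        \<open>c \<in> Q\<close>, and it avoids \<open>?b\<close>.\<close>
      fix x assume x: "x \<in> rep a"
      then obtain Q where "prime_ideal Q" "fst x \<subseteq> Q" "a \<notin> Q" "c \<in> Q"
        using diff[of "fst x"] by (auto simp: rep_def)
      with x show "x \<in> {x \<in> ?Y. \<exists>y\<in>rep a - ?b. ?r x y}"
        by (auto simp: rep_def intro!: bexI[of _ "(Q, True)"])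
    qed (auto simp: rep_def)
    moreover have "?b \<subseteq> rep a" by (auto simp: rep_def)
    ultimately show "?b \<lless>\<^bsub>downset_algebra ?Y ?r\<^esub> rep a"
      unfolding strongly_below_def le_downset_algebra downset_algebra_sel by blast
  qed
qed

section \<open>Splitting: two copies of the part to be divided\<close>

lemma existentially_closed_V2_splitting:
  assumes ec: "existentially_closed_V2 L"
  shows "axiom_S2 L"
  unfolding axiom_S2_def
proof (intro ballI impI, elim conjE)
  fix a b1 b2
  assume a: "a \<in> carrier L" and b: "b1 \<in> carrier L" "b2 \<in> carrier L"
    and ba: "b1 \<squnion>\<^bsub>L\<^esub> b2 \<lless>\<^bsub>L\<^esub> a" and a0: "a \<noteq> \<zero>\<^bsub>L\<^esub>"
    and reg: "b1 \<sqinter>\<^bsub>L\<^esub> b2 \<sqinter>\<^bsub>L\<^esub> (\<one>\<^bsub>L\<^esub> \<ominus>\<^bsub>L\<^esub> (\<one>\<^bsub>L\<^esub> \<ominus>\<^bsub>L\<^esub> a)) = \<zero>\<^bsub>L\<^esub>"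
  interpret V2_algebra L using ec by (simp add: existentially_closed_V2_def)
  have diff: "\<exists>Q. prime_ideal Q \<and> P \<subseteq> Q \<and> a \<notin> Q \<and> b1 \<in> Q \<and> b2 \<in> Q"
    if "prime_ideal P" "a \<notin> P" for P
    using prime_ideal_diff_iff[OF that(1) a join_closed[OF b]] ba that b
    by (auto simp: strongly_below_def prime_ideal_join_iff)
  have sub: "b1 \<in> P \<and> b2 \<in> P" if "prime_ideal P" "a \<in> P" for P
  proof -
    have "b1 \<squnion>\<^bsub>L\<^esub> b2 \<in> P"
      using ba b that by (auto simp: strongly_below_def prime_ideal_def intro: ideal_down)
    then show ?thesis using that b by (simp add: prime_ideal_join_iff)
  qed
  have pos: "\<exists>P. prime_ideal P \<and> a \<notin> P"
    using prime_ideals_separate[OF a bottom_closed] a0 ideal_zero by (auto simp: prime_ideal_def)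
  \<comment> \<open>As \<open>P\<close> is prime and misses \<open>b1\<close> and \<open>b2\<close>,
    the hypothesis puts \<open>\<one> \<ominus> (\<one> \<ominus> a)\<close> into \<open>P\<close>.
    Hence no prime ideal above \<open>P\<close> contains \<open>\<one> \<ominus> a\<close>, and each
    extends to one containing \<open>a\<close>.\<close>
  have top: "\<exists>R. prime_ideal R \<and> Q \<subseteq> R \<and> a \<in> R"
    if "prime_ideal P" "b1 \<notin> P" "b2 \<notin> P" "prime_ideal Q" "P \<subseteq> Q" for P Q
  proof -
    have "b1 \<sqinter>\<^bsub>L\<^esub> b2 \<sqinter>\<^bsub>L\<^esub> (\<one>\<^bsub>L\<^esub> \<ominus>\<^bsub>L\<^esub> (\<one>\<^bsub>L\<^esub> \<ominus>\<^bsub>L\<^esub> a)) \<in> P"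
      using reg that by (simp add: prime_ideal_def ideal_zero)
    then have "\<one>\<^bsub>L\<^esub> \<ominus>\<^bsub>L\<^esub> (\<one>\<^bsub>L\<^esub> \<ominus>\<^bsub>L\<^esub> a) \<in> P"
      using that a b by (simp add: prime_ideal_meet_iff)
    then have "\<one>\<^bsub>L\<^esub> \<ominus>\<^bsub>L\<^esub> a \<notin> Q"
      using prime_ideal_diff_iff[OF that(1), of "\<one>\<^bsub>L\<^esub>" "\<one>\<^bsub>L\<^esub> \<ominus>\<^bsub>L\<^esub> a"] that a
      unfolding prime_ideal_def by blast
    then show ?thesis using prime_ideal_diff_iff[OF that(4)] a by auto
  qed
  \<comment> \<open>The two copies of a prime ideal are equivalent, rather than identified, wherever they are
      meant to coincide; only a preorder is needed.\<close>
  let ?Y = "{(P, i). prime_ideal P \<and> (if i then b1 \<in> P \<longrightarrow> b2 \<in> P else b2 \<in> P \<longrightarrow> b1 \<in> P)}"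
  let ?r = "\<lambda>(P, i) (Q, j). P \<subseteq> Q \<and> (i = j \<or> a \<in> Q \<or> (b1 \<notin> P \<and> b2 \<notin> P))"
  \<comment> \<open>An ideal missing exactly one of \<open>b1\<close>, \<open>b2\<close> has a
    single copy: \<open>True\<close> if it misses \<open>b1\<close>, \<open>False\<close> if it
    misses \<open>b2\<close>. This places \<open>rep b1\<close> and \<open>rep b2\<close> on the
    prescribed sides.\<close>
  interpret prime_ideal_cover L ?Y ?r fst
  proof (unfold_locales, goal_cases)
    case (2 x y z)
    obtain P i Q j R k where eq: "x = (P, i)" "y = (Q, j)" "z = (R, k)" by (metis prod.exhaust)
    have "P \<subseteq> Q" "Q \<subseteq> R" "i = j \<or> a \<in> Q \<or> (b1 \<notin> P \<and> b2 \<notin> P)"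
      "j = k \<or> a \<in> R \<or> (b1 \<notin> Q \<and> b2 \<notin> Q)"
      using 2(4,5) by (simp_all add: eq)
    \<comment> \<open>Membership of \<open>a\<close> passes to larger ideals and omission of
      \<open>b1\<close> and \<open>b2\<close> to smaller ones, so either licence to change the index
      survives composition.\<close>
    then show ?case unfolding eq prod.case by blast
  next
    case (3 x y z)
    obtain P i Q j R k where eq: "x = (P, i)" "y = (Q, j)" "z = (R, k)" by (metis prod.exhaust)
    have P: "prime_ideal P" "prime_ideal Q" "prime_ideal R" "P \<subseteq> Q" "P \<subseteq> R"
      using 3 by (auto simp: eq)
    show ?case
    proof (cases "b1 \<notin> P \<and> b2 \<notin> P")
      \<comment> \<open>The indices \<open>j\<close> and \<open>k\<close> may differ, so both ideals
        are first extended to contain \<open>a\<close>, where the copies are equivalent.\<close>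
      case True
      then obtain Q' R' where Q': "prime_ideal Q'" "Q \<subseteq> Q'" "a \<in> Q'"
        and R': "prime_ideal R'" "R \<subseteq> R'" "a \<in> R'"
        using top P by meson
      then obtain S where "prime_ideal S" "Q' \<subseteq> S" "R' \<subseteq> S"
        using prime_ideals_directed[of P Q' R'] P by blast
      then show ?thesis
        using Q' R' sub[of S] by (intro bexI[of _ "(S, True)"]) (auto simp: eq)
    next
      case False
      obtain S where S: "prime_ideal S" "Q \<subseteq> S" "R \<subseteq> S"
        using prime_ideals_directed[OF P] .
      \<comment> \<open>Since \<open>P\<close> contains \<open>b1\<close> or \<open>b2\<close>, the
        index can have changed only on reaching an ideal that contains \<open>a\<close>; thus
        \<open>i\<close> serves for \<open>S\<close>.\<close>
      have "i = j \<or> a \<in> S" "i = k \<or> a \<in> S" using 3 False S by (auto simp: eq)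
      then show ?thesis
        using S 3 False sub[of S] by (intro bexI[of _ "(S, i)"]) (auto simp: eq split: if_splits)
    qed
  next
    case (5 P)
    then show ?case by (cases "b2 \<in> P") force+
  next
    case (7 x Q)
    obtain P i where eq: "x = (P, i)" by (metis prod.exhaust)
    \<comment> \<open>If copy \<open>i\<close> of \<open>Q\<close> is absent, \<open>Q\<close>
      misses one of \<open>b1\<close>, \<open>b2\<close>; then \<open>P\<close> misses it too, and
      \<open>(P, i) \<in> ?Y\<close> makes \<open>P\<close> miss both, so the index may
      change.\<close>
    consider "(Q, i) \<in> ?Y" | "(Q, \<not> i) \<in> ?Y" "b1 \<notin> P \<and> b2 \<notin> P"
      using 7 by (auto simp: eq split: if_splits)
    then show ?case
    proof cases
      case 1
      then show ?thesis using 7 by (intro bexI[of _ "(Q, i)"]) (auto simp: eq)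
    next
      case 2
      then show ?thesis using 7 by (intro bexI[of _ "(Q, \<not> i)"]) (auto simp: eq)
    qed
  qed auto
  \<comment> \<open>This is the down-set generated by the copies with index \<open>s\<close> of
    ideals omitting \<open>a\<close>.\<close>
  let ?A = "\<lambda>s. {(P, i) \<in> ?Y. a \<notin> P \<and> (i = s \<or> (b1 \<notin> P \<and> b2 \<notin> P))}"
  have closed: "?A s \<in> carrier (downset_algebra ?Y ?r)" for s by auto
  have nonempty: "?A s \<noteq> {}" for s
  proof -
    obtain Q where "prime_ideal Q" "a \<notin> Q" "b1 \<in> Q" "b2 \<in> Q" using pos diff by blast
    then have "(Q, s) \<in> ?A s" by simp
    then show ?thesis by blast
  qed
  have compl: "{x \<in> ?Y. \<exists>y\<in>rep a - ?A (\<not> s). ?r x y} = ?A s" for s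
  proof (intro equalityI subsetI)
    fix x assume "x \<in> {x \<in> ?Y. \<exists>y\<in>rep a - ?A (\<not> s). ?r x y}"
    then show "x \<in> ?A s" by (auto simp: rep_def)
  next
    fix x assume x: "x \<in> ?A s"
    then obtain P i where eq: "x = (P, i)" by (metis prod.exhaust)
    with x obtain Q where Q: "prime_ideal Q" "P \<subseteq> Q" "a \<notin> Q" "b1 \<in> Q" "b2 \<in> Q"
      using diff[of P] by auto
    \<comment> \<open>Since \<open>Q\<close> contains \<open>b1\<close> and \<open>b2\<close>, both
      its copies exist, and the one with index \<open>s\<close> is not in the other half.\<close>
    then have "(Q, s) \<in> rep a - ?A (\<not> s)" by (auto simp: rep_def)
    moreover have "?r x (Q, s)" using x Q by (auto simp: eq)
    ultimately show "x \<in> {x \<in> ?Y. \<exists>y\<in>rep a - ?A (\<not> s). ?r x y}" using x by blast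
  qed
  show "\<exists>a1\<in>carrier L. \<exists>a2\<in>carrier L. a1 \<noteq> \<zero>\<^bsub>L\<^esub> \<and> a2 \<noteq> \<zero>\<^bsub>L\<^esub> \<and>
      a \<ominus>\<^bsub>L\<^esub> a2 = a1 \<and> b1 \<sqsubseteq>\<^bsub>L\<^esub> a1 \<and> a \<ominus>\<^bsub>L\<^esub> a1 = a2 \<and> b2 \<sqsubseteq>\<^bsub>L\<^esub> a2 \<and>
      a1 \<sqinter>\<^bsub>L\<^esub> a2 = b1 \<sqinter>\<^bsub>L\<^esub> b2"
  proof (rule existentially_closed_V2_pull_splitting[OF ec V2_downset_algebra embedding_rep a b])
    show "?A True \<in> carrier (downset_algebra ?Y ?r)" "?A False \<in> carrier (downset_algebra ?Y ?r)"
      by (fact closed)+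
    show "?A True \<noteq> \<zero>\<^bsub>downset_algebra ?Y ?r\<^esub>" "?A False \<noteq> \<zero>\<^bsub>downset_algebra ?Y ?r\<^esub>"
      unfolding downset_algebra_sel by (fact nonempty)+
    show "rep a \<ominus>\<^bsub>downset_algebra ?Y ?r\<^esub> ?A False = ?A True"
      using compl[of True] unfolding downset_algebra_sel not_True_eq_False .
    show "rep a \<ominus>\<^bsub>downset_algebra ?Y ?r\<^esub> ?A True = ?A False"
      using compl[of False] unfolding downset_algebra_sel not_False_eq_True .
    show "rep b1 \<sqsubseteq>\<^bsub>downset_algebra ?Y ?r\<^esub> ?A True" "rep b2 \<sqsubseteq>\<^bsub>downset_algebra ?Y ?r\<^esub> ?A False"
      using sub unfolding le_downset_algebra by (auto simp: rep_def split: if_splits)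
    \<comment> \<open>No index is both \<open>True\<close> and \<open>False\<close>, so a common
      point must omit both \<open>b1\<close> and \<open>b2\<close>.\<close>
    show "?A True \<sqinter>\<^bsub>downset_algebra ?Y ?r\<^esub> ?A False =
        rep b1 \<sqinter>\<^bsub>downset_algebra ?Y ?r\<^esub> rep b2"
      using sub unfolding downset_algebra_sel by (auto simp: rep_def split: if_splits)
  qed
qed

theorem theorem5p4:
  fixes L :: "'a coheyting"
  assumes "existentially_closed_V2 L"
  shows "axiom_D2 L \<and> axiom_S2 L"
  using assms existentially_closed_V2_density existentially_closed_V2_splitting by blast

end
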